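(* Let $y_h\in\mathcal{Y}^h$ satisfy $\min_k\nabla y_h|_{T_k}>0$, let $f\in\mathcal{U}^\varepsilon$, and for each $k\in\mathscr{K}^c_{\mathscr{T}_h}$ let $\bar f_{T_k}\in\mathbb{R}$ (a chosen average of $f$ on $T_k$). For $v\in\mathcal{U}^\varepsilon$ let $v_h$ be its nodal interpolant, i.e. the $2N$-periodic lattice function that is affine on each element $T_k$ and satisfies $(v_h)_{\ell_k}=v_{\ell_k}$ for all $k$, and set $$R_{\rm cg}[v]:=\varepsilon\sum_{\ell\in\mathcal{L}}\sigma^{\rm ac}_\ell(y_h)v'_\ell-\varepsilon\sum_{\ell\in\mathcal{L}}\sigma^{\rm ac}_\ell(y_h)(v_h)'_\ell-\varepsilon\sum_{\ell\in\mathcal{L}}f_\ell v_\ell+\varepsilon\sum_{\ell\in\mathcal{L}}f_\ell (v_h)_\ell .$$ Then $$\|R_{\rm cg}\|_{\mathcal{U}^{-1,2}}\le\Big\{\sum_{k\in\mathscr{K}^c_{\mathscr{T}_h}}(\eta^{\rm cg}_{T_k})^2+\frac12\sum_{k\in\mathscr{K}^c_{\mathscr{T}_h}}h_{T_k}^2\|f-\bar f_{T_k}\|^2_{\ell^2_\varepsilon(\mathcal{L}_{T_k})}\Big\}^{1/2}=\Big\{\sum_{k\in\mathscr{K}^c}(\eta^{\rm cg}_k)^2+\frac12\sum_{k\in\mathscr{K}^c_{\mathscr{T}_h}}h_{T_k}^2\|f-\bar f_{T_k}\|^2_{\ell^2_\varepsilon(\mathcal{L}_{T_k})}\Big\}^{1/2},$$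 where $(\eta^{\rm cg}_{T_k})^2:=\frac12h_{T_k}^2\,\varepsilon\sum_{\ell\in\mathcal{L}_{T_k}}(\bar f_{T_k})^2$ and $$\eta^{\rm cg}_k=\begin{cases}\frac{\sqrt2}{2}\sqrt{(\eta^{\rm cg}_{T_k})^2+(\eta^{\rm cg}_{T_{k+1}})^2}, & k\in\mathring{\mathscr{K}}^c,\\ \frac{\sqrt2}{2}\eta^{\rm cg}_{T_{K_1-2}}, & k=K_1-2,\\ \frac{\sqrt2}{2}\eta^{\rm cg}_{T_{K_2+3}}, & k=K_2+2.\end{cases}$$
   Context: **Lattice.** $N\in\mathbb{N}$, $\varepsilon=1/N$, $F>0$, $\mathcal{L}=\{-N+1,\dots,N\}$. $\mathcal{U}^\varepsilon$ is the space of $2N$-periodic $v:\mathbb{Z}\to\mathbb{R}$ with $\sum_{\ell\in\mathcal{L}}v_\ell=0$; $\mathcal{Y}^\varepsilon=\{y:\ y_\ell=\varepsilon F\ell+v_\ell,\ v\in\mathcal{U}^\varepsilon\}$. $v'_\ell:=(v_\ell-v_{\ell-1})/\varepsilon$; $D_jy_\ell:=(y_{\ell+j}-y_\ell)/\varepsilon$ for $j\in\{1,2,-1,-2\}$ and $Dy_\ell:=(D_1y_\ell,D_2y_\ell,D_{-1}y_\ell,D_{-2}y_\ell)$. $\|v\|_{\ell^2_\varepsilon(\mathcal{D})}:=(\varepsilon\sum_{\ell\in\mathcal{D}}|v_\ell|^2)^{1/2}$, with $\mathcal{D}=\mathcal{L}$ if omitted. For a linear functional $T$ on $\mathcal{U}^\varepsilon$,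 $\|T\|_{\mathcal{U}^{-1,2}}:=\sup\{T[v]: v\in\mathcal{U}^\varepsilon,\ \|v'\|_{\ell^2_\varepsilon}=1\}$. **Potential.** $V\in C^3((0,\infty)^2\times(-\infty,0)^2;\mathbb{R})$, arguments labelled $(g_1,g_2,g_{-1},g_{-2})$, $\partial_iV=\partial V/\partial g_i$. $W(G):=V(G,2G,-G,-2G)$ for $G>0$. **Mesh.** Nodes $\ell_1<\dots<\ell_K=N$ in $\mathcal{L}$, extended by $\ell_{k+K}=\ell_k+2N$ (all node/element indices are understood $K$-periodically). $T_k=[\varepsilon\ell_{k-1},\varepsilon\ell_k]$, $h_{T_k}=\varepsilon(\ell_k-\ell_{k-1})$, $\mathcal{L}_{T_k}=\{\ell_{k-1}+1,\dots,\ell_k\}$. Indices $K_1,K_2$ satisfy $K_1\ge3$, $K_1+2<K_2-1$, $K_2+3\le K$, and $\ell_k-\ell_{k-1}=1$ for $K_1-1\le k\le K_2+2$ (atomistic nodes: $K_1+1,\dots,K_2-1$; interface nodes: $K_1-1,K_1,K_2,K_2+1$; the rest continuum). $\mathscr{K}^c=\{1,\dots,K_1-2,K_2+2,\dots,K\}$, $\mathring{\mathscr{K}}^c=\mathscr{K}^c\setminus\{K_1-2,K_2+2\}$, $\mathscr{K}^c_{\mathscr{T}_h}=\mathscr{K}^c\setminus\{K_2+2\}$. $\mathcal{Y}^h$ is the set of $y\in\mathcal{Y}^\varepsilon$ that are affine on every $T_k$ (i.e. $y'_\ell$ is constant for $\ell\in\mathcal{L}_{T_k}$, the constant being $\nabla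 y|_{T_k}$). **Stresses.** $\sigma^{\rm a}_\ell(y)=\partial_1V(Dy_{\ell-1})-\partial_{-1}V(Dy_\ell)+\partial_2V(Dy_{\ell-2})+\partial_2V(Dy_{\ell-1})-\partial_{-2}V(Dy_\ell)-\partial_{-2}V(Dy_{\ell+1})$. For $y\in\mathcal{Y}^h$ write $V_j(\ell)=\partial_jV(Dy_\ell)$, $V^-_j(\ell)=\partial_jV(D_1y_\ell,D_2y_\ell,D_{-1}y_\ell,2D_{-1}y_\ell)$, $V^+_j(\ell)=\partial_jV(D_1y_\ell,2D_1y_\ell,D_{-1}y_\ell,D_{-2}y_\ell)$. The coupled elementwise stress $\bar\sigma^{\rm ac}_k(y)$ is: - $W'(\nabla y|_{T_k})$ for $k\in\mathscr{K}^c_{\mathscr{T}_h}$; $\sigma^{\rm a}_{\ell_k}(y)$ for $K_1+3\le k\le K_2-2$; - $k=K_1-1$: $\frac12W'(\nabla y|_{T_k})-V^-_{-1}(\ell_k)-2V^-_{-2}(\ell_k)$; - $k=K_1$: $V^-_1(\ell_{k-1})-V^-_{-1}(\ell_k)+V^-_2(\ell_{k-1})-2V^-_{-2}(\ell_k)-V_{-2}(\ell_{k+1})$; - $k=K_1+1$: $V^-_1(\ell_{k-1})-V_{-1}(\ell_k)+V^-_2(\ell_{k-2})+V^-_2(\ell_{k-1})-V_{-2}(\ell_k)-V_{-2}(\ell_{k+1})$; - $k=K_1+2$: $V_1(\ell_{k-1})-V_{-1}(\ell_k)+V^-_2(\ell_{k-2})+V_2(\ell_{k-1})-V_{-2}(\ell_k)-V_{-2}(\ell_{k+1})$;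 - $k=K_2-1$: $V_1(\ell_{k-1})-V_{-1}(\ell_k)+V_2(\ell_{k-1})+V_2(\ell_{k-2})-V_{-2}(\ell_k)-V^+_{-2}(\ell_{k+1})$; - $k=K_2$: $V_1(\ell_{k-1})-V^+_{-1}(\ell_k)+V_2(\ell_{k-1})+V_2(\ell_{k-2})-V^+_{-2}(\ell_k)-V^+_{-2}(\ell_{k+1})$; - $k=K_2+1$: $V^+_1(\ell_{k-1})-V^+_{-1}(\ell_k)+V_2(\ell_{k-2})+2V^+_2(\ell_{k-1})-V^+_{-2}(\ell_k)$; - $k=K_2+2$: $\frac12W'(\nabla y|_{T_k})+V^+_1(\ell_{k-1})+2V^+_2(\ell_{k-1})$. The latticewise stress is $\sigma^{\rm ac}_\ell(y):=\bar\sigma^{\rm ac}_k(y)$ for $\ell\in\mathcal{L}_{T_k}$, extended $2N$-periodically in $\ell$. The scalar $\bar f_{T_k}$ is identified with the constant function in expressions such as $\|f-\bar f_{T_k}\|_{\ell^2_\varepsilon(\mathcal{L}_{T_k})}$. *)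

theory Defs
  imports "HOL-Analysis.Analysis"
begin

primrec Ck_on :: "nat \<Rightarrow> ('a::euclidean_space \<Rightarrow> real) \<Rightarrow> 'a set \<Rightarrow> bool" where
  "Ck_on 0 f S \<longleftrightarrow> continuous_on S f"
| "Ck_on (Suc n) f S \<longleftrightarrow> f differentiable_on S \<and>
     (\<forall>b\<in>Basis. Ck_on n (\<lambda>x. frechet_derivative f (at x) b) S)"

text \<open>A potential takes the strains in the order (g_1, g_2, g_{-1}, g_{-2}).\<close>

type_synonym strain = "real \<times> real \<times> real \<times> real"

definition pot_domain :: "strain set" where
  "pot_domain = {0<..} \<times> {0<..} \<times> {..<0} \<times> {..<0}"

text \<open>The index j of the partial derivative is one of the labels 1, 2, -1, -2.\<close>

definition pderivV :: "(strain \<Rightarrow> real) \<Rightarrow> int \<Rightarrow> strain \<Rightarrow> real" where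
  "pderivV V j = (\<lambda>(a, b, c, d).
     if j = 1 then deriv (\<lambda>t. V (t, b, c, d)) a
     else if j = 2 then deriv (\<lambda>t. V (a, t, c, d)) b
     else if j = -1 then deriv (\<lambda>t. V (a, b, t, d)) c
     else deriv (\<lambda>t. V (a, b, c, t)) d)"

definition cbW :: "(strain \<Rightarrow> real) \<Rightarrow> real \<Rightarrow> real" where
  "cbW V G = V (G, 2 * G, - G, - 2 * G)"

definition lat_eps :: "nat \<Rightarrow> real" where
  "lat_eps N = 1 / real N"

definition lat_sites :: "nat \<Rightarrow> int set" where
  "lat_sites N = {- int N + 1 .. int N}"

definition lat_periodic :: "nat \<Rightarrow> (int \<Rightarrow> real) \<Rightarrow> bool" where
  "lat_periodic N v \<longleftrightarrow> (\<forall>l. v (l + 2 * int N) = v l)"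

definition U_space :: "nat \<Rightarrow> (int \<Rightarrow> real) set" where
  "U_space N = {v. lat_periodic N v \<and> (\<Sum>l\<in>lat_sites N. v l) = 0}"

definition Y_space :: "nat \<Rightarrow> real \<Rightarrow> (int \<Rightarrow> real) set" where
  "Y_space N F = {y. \<exists>v\<in>U_space N. \<forall>l. y l = lat_eps N * F * of_int l + v l}"

definition bdiff :: "nat \<Rightarrow> (int \<Rightarrow> real) \<Rightarrow> int \<Rightarrow> real" where
  "bdiff N v l = (v l - v (l - 1)) / lat_eps N"

definition Dj :: "nat \<Rightarrow> (int \<Rightarrow> real) \<Rightarrow> int \<Rightarrow> int \<Rightarrow> real" where
  "Dj N y j l = (y (l + j) - y l) / lat_eps N"

definition DD :: "nat \<Rightarrow> (int \<Rightarrow> real) \<Rightarrow> int \<Rightarrow> strain" where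
  "DD N y l = (Dj N y 1 l, Dj N y 2 l, Dj N y (-1) l, Dj N y (-2) l)"

definition l2norm :: "nat \<Rightarrow> int set \<Rightarrow> (int \<Rightarrow> real) \<Rightarrow> real" where
  "l2norm N D v = sqrt (lat_eps N * (\<Sum>l\<in>D. \<bar>v l\<bar>\<^sup>2))"

text \<open>The supremum is taken in the extended reals, so that an upper bound on it is
  meaningful without a separate proof that the set of values is bounded.\<close>

definition dual_norm :: "nat \<Rightarrow> ((int \<Rightarrow> real) \<Rightarrow> real) \<Rightarrow> ereal" where
  "dual_norm N T =
     (SUP v\<in>{v\<in>U_space N. l2norm N (lat_sites N) (bdiff N v) = 1}. ereal (T v))"

text \<open>Nodes are a function on all integers, extended quasi-periodically.  Elements are
  identified with their index k: element k lies between the nodes k - 1 and k.\<close>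

definition mesh :: "nat \<Rightarrow> int \<Rightarrow> int \<Rightarrow> int \<Rightarrow> (int \<Rightarrow> int) \<Rightarrow> bool" where
  "mesh N K K1 K2 nd \<longleftrightarrow>
     3 \<le> K1 \<and> K1 + 2 < K2 - 1 \<and> K2 + 3 \<le> K \<and>
     nd ` {1..K} \<subseteq> lat_sites N \<and> strict_mono_on {1..K} nd \<and> nd K = int N \<and>
     (\<forall>k. nd (k + K) = nd k + 2 * int N) \<and>
     (\<forall>k\<in>{K1 - 1..K2 + 2}. nd k - nd (k - 1) = 1)"

definition elt_h :: "nat \<Rightarrow> (int \<Rightarrow> int) \<Rightarrow> int \<Rightarrow> real" where
  "elt_h N nd k = lat_eps N * of_int (nd k - nd (k - 1))"

definition elt_sites :: "(int \<Rightarrow> int) \<Rightarrow> int \<Rightarrow> int set" where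
  "elt_sites nd k = {nd (k - 1) + 1 .. nd k}"

definition Kc :: "int \<Rightarrow> int \<Rightarrow> int \<Rightarrow> int set" where
  "Kc K K1 K2 = {1..K1 - 2} \<union> {K2 + 2..K}"

definition Kc_interior :: "int \<Rightarrow> int \<Rightarrow> int \<Rightarrow> int set" where
  "Kc_interior K K1 K2 = Kc K K1 K2 - {K1 - 2, K2 + 2}"

definition Kc_elts :: "int \<Rightarrow> int \<Rightarrow> int \<Rightarrow> int set" where
  "Kc_elts K K1 K2 = Kc K K1 K2 - {K2 + 2}"

definition per_index :: "int \<Rightarrow> int \<Rightarrow> int" where
  "per_index K k = (k - 1) mod K + 1"

definition elt_affine :: "nat \<Rightarrow> (int \<Rightarrow> int) \<Rightarrow> (int \<Rightarrow> real) \<Rightarrow> bool" where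
  "elt_affine N nd w \<longleftrightarrow> (\<forall>k. \<exists>c. \<forall>l\<in>elt_sites nd k. bdiff N w l = c)"

definition Yh_space :: "nat \<Rightarrow> real \<Rightarrow> (int \<Rightarrow> int) \<Rightarrow> (int \<Rightarrow> real) set" where
  "Yh_space N F nd = {y\<in>Y_space N F. elt_affine N nd y}"

text \<open>The constant value of the difference quotient on element k, read off at its last site.\<close>

definition elt_grad :: "nat \<Rightarrow> (int \<Rightarrow> int) \<Rightarrow> (int \<Rightarrow> real) \<Rightarrow> int \<Rightarrow> real" where
  "elt_grad N nd y k = bdiff N y (nd k)"

definition nodal_interp :: "nat \<Rightarrow> (int \<Rightarrow> int) \<Rightarrow> (int \<Rightarrow> real) \<Rightarrow> int \<Rightarrow> real" where
  "nodal_interp N nd v =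
     (THE w. lat_periodic N w \<and> elt_affine N nd w \<and> (\<forall>k. w (nd k) = v (nd k)))"

definition sigma_a :: "nat \<Rightarrow> (strain \<Rightarrow> real) \<Rightarrow> (int \<Rightarrow> real) \<Rightarrow> int \<Rightarrow> real" where
  "sigma_a N V y l =
     pderivV V 1 (DD N y (l - 1)) - pderivV V (-1) (DD N y l)
     + pderivV V 2 (DD N y (l - 2)) + pderivV V 2 (DD N y (l - 1))
     - pderivV V (-2) (DD N y l) - pderivV V (-2) (DD N y (l + 1))"

definition Vat :: "nat \<Rightarrow> (strain \<Rightarrow> real) \<Rightarrow> (int \<Rightarrow> real) \<Rightarrow> int \<Rightarrow> int \<Rightarrow> real" where
  "Vat N V y j l = pderivV V j (DD N y l)"

definition Vminus :: "nat \<Rightarrow> (strain \<Rightarrow> real) \<Rightarrow> (int \<Rightarrow> real) \<Rightarrow> int \<Rightarrow> int \<Rightarrow> real" where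
  "Vminus N V y j l =
     pderivV V j (Dj N y 1 l, Dj N y 2 l, Dj N y (-1) l, 2 * Dj N y (-1) l)"

definition Vplus :: "nat \<Rightarrow> (strain \<Rightarrow> real) \<Rightarrow> (int \<Rightarrow> real) \<Rightarrow> int \<Rightarrow> int \<Rightarrow> real" where
  "Vplus N V y j l =
     pderivV V j (Dj N y 1 l, 2 * Dj N y 1 l, Dj N y (-1) l, Dj N y (-2) l)"

definition sigma_ac_elt ::
  "nat \<Rightarrow> int \<Rightarrow> int \<Rightarrow> int \<Rightarrow> (int \<Rightarrow> int) \<Rightarrow> (strain \<Rightarrow> real) \<Rightarrow> (int \<Rightarrow> real) \<Rightarrow> int \<Rightarrow> real" where
  "sigma_ac_elt N K K1 K2 nd V y k =
    (let A = Vat N V y; M = Vminus N V y; P = Vplus N V y;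
         W' = deriv (cbW V) (elt_grad N nd y k) in
     if k \<in> Kc_elts K K1 K2 then W'
     else if k = K1 - 1 then
       W' / 2 - M (-1) (nd k) - 2 * M (-2) (nd k)
     else if k = K1 then
       M 1 (nd (k - 1)) - M (-1) (nd k) + M 2 (nd (k - 1))
       - 2 * M (-2) (nd k) - A (-2) (nd (k + 1))
     else if k = K1 + 1 then
       M 1 (nd (k - 1)) - A (-1) (nd k) + M 2 (nd (k - 2)) + M 2 (nd (k - 1))
       - A (-2) (nd k) - A (-2) (nd (k + 1))
     else if k = K1 + 2 then
       A 1 (nd (k - 1)) - A (-1) (nd k) + M 2 (nd (k - 2)) + A 2 (nd (k - 1))
       - A (-2) (nd k) - A (-2) (nd (k + 1))
     else if k = K2 - 1 then
       A 1 (nd (k - 1)) - A (-1) (nd k) + A 2 (nd (k - 1)) + A 2 (nd (k - 2))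
       - A (-2) (nd k) - P (-2) (nd (k + 1))
     else if k = K2 then
       A 1 (nd (k - 1)) - P (-1) (nd k) + A 2 (nd (k - 1)) + A 2 (nd (k - 2))
       - P (-2) (nd k) - P (-2) (nd (k + 1))
     else if k = K2 + 1 then
       P 1 (nd (k - 1)) - P (-1) (nd k) + A 2 (nd (k - 2)) + 2 * P 2 (nd (k - 1))
       - P (-2) (nd k)
     else if k = K2 + 2 then
       W' / 2 + P 1 (nd (k - 1)) + 2 * P 2 (nd (k - 1))
     else sigma_a N V y (nd k))"

text \<open>The element among 1, ..., K containing the representative of l modulo 2N
  in the fundamental cell.\<close>

definition elt_of :: "nat \<Rightarrow> int \<Rightarrow> (int \<Rightarrow> int) \<Rightarrow> int \<Rightarrow> int" where
  "elt_of N K nd l =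
     (THE k. k \<in> {1..K} \<and>
       (l + int N - 1) mod (2 * int N) - int N + 1 \<in> elt_sites nd k)"

definition sigma_ac ::
  "nat \<Rightarrow> int \<Rightarrow> int \<Rightarrow> int \<Rightarrow> (int \<Rightarrow> int) \<Rightarrow> (strain \<Rightarrow> real) \<Rightarrow> (int \<Rightarrow> real) \<Rightarrow> int \<Rightarrow> real" where
  "sigma_ac N K K1 K2 nd V y l = sigma_ac_elt N K K1 K2 nd V y (elt_of N K nd l)"

definition R_cg ::
  "nat \<Rightarrow> int \<Rightarrow> int \<Rightarrow> int \<Rightarrow> (int \<Rightarrow> int) \<Rightarrow> (strain \<Rightarrow> real) \<Rightarrow> (int \<Rightarrow> real) \<Rightarrow> (int \<Rightarrow> real)
    \<Rightarrow> (int \<Rightarrow> real) \<Rightarrow> real" where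
  "R_cg N K K1 K2 nd V y f v =
    (let vh = nodal_interp N nd v; s = sigma_ac N K K1 K2 nd V y in
       lat_eps N * (\<Sum>l\<in>lat_sites N. s l * bdiff N v l)
     - lat_eps N * (\<Sum>l\<in>lat_sites N. s l * bdiff N vh l)
     - lat_eps N * (\<Sum>l\<in>lat_sites N. f l * v l)
     + lat_eps N * (\<Sum>l\<in>lat_sites N. f l * vh l))"

definition eta_elt :: "nat \<Rightarrow> (int \<Rightarrow> int) \<Rightarrow> (int \<Rightarrow> real) \<Rightarrow> int \<Rightarrow> real" where
  "eta_elt N nd fbar k =
     sqrt ((elt_h N nd k)\<^sup>2 * (lat_eps N * (\<Sum>l\<in>elt_sites nd k. (fbar k)\<^sup>2)) / 2)"

text \<open>For k = K the successor element k + 1 is element 1, by periodicity of the indices.\<close>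

definition eta_node ::
  "nat \<Rightarrow> int \<Rightarrow> int \<Rightarrow> int \<Rightarrow> (int \<Rightarrow> int) \<Rightarrow> (int \<Rightarrow> real) \<Rightarrow> int \<Rightarrow> real" where
  "eta_node N K K1 K2 nd fbar k =
    (if k \<in> Kc_interior K K1 K2 then
       sqrt 2 / 2 * sqrt ((eta_elt N nd fbar k)\<^sup>2 + (eta_elt N nd fbar (per_index K (k + 1)))\<^sup>2)
     else if k = K1 - 2 then sqrt 2 / 2 * eta_elt N nd fbar (K1 - 2)
     else if k = K2 + 2 then sqrt 2 / 2 * eta_elt N nd fbar (K2 + 3)
     else 0)"

definition data_osc ::
  "nat \<Rightarrow> int \<Rightarrow> int \<Rightarrow> int \<Rightarrow> (int \<Rightarrow> int) \<Rightarrow> (int \<Rightarrow> real) \<Rightarrow> (int \<Rightarrow> real) \<Rightarrow> real" where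
  "data_osc N K K1 K2 nd f fbar =
     (\<Sum>k\<in>Kc_elts K K1 K2.
        (elt_h N nd k)\<^sup>2 * (l2norm N (elt_sites nd k) (\<lambda>l. f l - fbar k))\<^sup>2)"

end

theory Submission
  imports Defs
begin

text \<open>The coupled stress is constant on each element, and \<open>v'\<close> and \<open>v\<^sub>h'\<close> have the same sum
  there, so the stress terms cancel and only the pairing of \<open>-f\<close> with \<open>v - v\<^sub>h\<close> remains.
  It vanishes on elements of one site.  On the others a discrete Poincare inequality with constant
  \<open>h\<^sub>T/2\<close>, the splitting of \<open>f\<close> into its average and the oscillation, and Cauchy-Schwarz
  on each element and then over the elements give the bound.  In the nodal form each element estimate
  is shared equally between the two end nodes of the element.\<close>

subsection \<open>Sums over integer intervals\<close>

text \<open>Intervals are written \<open>{a+1..b}\<close> throughout, the form of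
  \<open>elt_sites\<close>; for \<open>a = b\<close> the sum is empty, which is where the inductions
  start.\<close>

lemma sum_int_upper_Suc:
  fixes g :: "int \<Rightarrow> 'a::comm_monoid_add"
  assumes "a \<le> b"
  shows "(\<Sum>l\<in>{a+1..b+1}. g l) = (\<Sum>l\<in>{a+1..b}. g l) + g (b + 1)"
proof -
  have "{a+1..b+1} = insert (b+1) {a+1..b}" using assms by auto
  then show ?thesis by (simp add: add.commute)
qed

lemma sum_int_telescope:
  fixes g :: "int \<Rightarrow> 'a::ab_group_add"
  assumes "a \<le> b"
  shows "(\<Sum>l\<in>{a+1..b}. g l - g (l - 1)) = g b - g a"
  using assms
proof (induction b rule: int_ge_induct)
  case base
  then show ?case by simp
next
  case (step b)
  then show ?case by (simp add: sum_int_upper_Suc)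
qed

lemma sum_int_concat:
  fixes g :: "int \<Rightarrow> 'a::comm_monoid_add"
  assumes "a \<le> c" "c \<le> b"
  shows "(\<Sum>l\<in>{a+1..b}. g l) = (\<Sum>l\<in>{a+1..c}. g l) + (\<Sum>l\<in>{c+1..b}. g l)"
proof -
  have "{a+1..b} = {a+1..c} \<union> {c+1..b}" using assms by auto
  then show ?thesis by (simp add: sum.union_disjoint)
qed

text \<open>Cauchy-Schwarz for the increments against the constant 1; the factor
  \<open>b - a\<close> counts the increments.\<close>

lemma telescope_square_le:
  fixes g :: "int \<Rightarrow> real"
  assumes "a \<le> b"
  shows "(g b - g a)\<^sup>2 \<le> of_int (b - a) * (\<Sum>l\<in>{a+1..b}. (g l - g (l - 1))\<^sup>2)"
  using sum_squared_le_sum_of_squares[of "\<lambda>l. g l - g (l - 1)" "{a+1..b}"] assms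
  by (simp add: sum_int_telescope mult.commute)

text \<open>Bounding \<open>g l\<close> from both ends of the interval and adding with weights proportional to
  the distances is what gains the factor 1/4.\<close>

lemma discrete_poincare:
  fixes g :: "int \<Rightarrow> real"
  assumes "a < b" and "g a = 0" and "g b = 0"
  shows "(\<Sum>l\<in>{a+1..b}. (g l)\<^sup>2)
    \<le> (of_int (b - a))\<^sup>2 / 4 * (\<Sum>l\<in>{a+1..b}. (g l - g (l - 1))\<^sup>2)"
proof -
  define S where "S = (\<Sum>l\<in>{a+1..b}. (g l - g (l - 1))\<^sup>2)"
  have pt: "(g l)\<^sup>2 \<le> of_int (b - a) / 4 * S" if l: "l \<in> {a+1..b}" for l
  proof -
    define x y :: real where "x = of_int (l - a)" and "y = of_int (b - l)"
    define S1 where "S1 = (\<Sum>j\<in>{a+1..l}. (g j - g (j - 1))\<^sup>2)"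
    define S2 where "S2 = (\<Sum>j\<in>{l+1..b}. (g j - g (j - 1))\<^sup>2)"
    have pos: "x \<ge> 0" "y \<ge> 0" "x + y > 0" using l assms by (auto simp: x_def y_def)
    have S: "S = S1 + S2" "S \<ge> 0"
      using l sum_int_concat[of a l b] by (auto simp: S_def S1_def S2_def sum_nonneg)
    have "(g l)\<^sup>2 \<le> x * S1"
      using telescope_square_le[of a l g] l assms by (simp add: x_def S1_def)
    then have 1: "y * (g l)\<^sup>2 \<le> y * (x * S1)" using pos by (intro mult_left_mono) auto
    have "(g l)\<^sup>2 \<le> y * S2"
      using telescope_square_le[of l b g] l assms by (simp add: y_def S2_def)
    then have 2: "x * (g l)\<^sup>2 \<le> x * (y * S2)" using pos by (intro mult_left_mono) auto
    have "(x + y) * (g l)\<^sup>2 \<le> (x * y) * S"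
      using 1 2 by (simp add: S algebra_simps)
    \<comment> \<open>AM-GM: \<open>x * y\<close> is at most a quarter of \<open>(x + y)^2\<close>,
      because \<open>(x - y)^2\<close> is nonnegative.\<close>
    also have "\<dots> \<le> ((x + y)\<^sup>2 / 4) * S"
      using S(2) sum_squares_ge_zero[of "x - y" 0]
      by (intro mult_right_mono) (auto simp: power2_eq_square field_simps)
    also have "\<dots> = (x + y) * ((x + y) / 4 * S)" by (simp add: power2_eq_square)
    finally have "(g l)\<^sup>2 \<le> (x + y) / 4 * S" using pos by (simp only: mult_le_cancel_left_pos)
    moreover have "x + y = of_int (b - a)" by (simp add: x_def y_def)
    ultimately show ?thesis by simp
  qed
  \<comment> \<open>The pointwise bound is independent of \<open>l\<close>, so summing over the
    \<open>b - a\<close> sites supplies the second factor \<open>b - a\<close>.\<close>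
  have "(\<Sum>l\<in>{a+1..b}. (g l)\<^sup>2) \<le> (\<Sum>l\<in>{a+1..b}. of_int (b - a) / 4 * S)"
    using pt by (intro sum_mono)
  also have "\<dots> = (of_int (b - a))\<^sup>2 / 4 * S"
    using assms by (simp add: power2_eq_square)
  finally show ?thesis by (simp add: S_def)
qed

text \<open>Pythagoras: the assumption makes the constant \<open>c\<close> orthogonal to
  \<open>d - c\<close>, and the sum of \<open>c^2\<close> is dropped. It serves to replace the
  increments of the interpolation error by those of \<open>v\<close>.\<close>

lemma sum_square_centered_le:
  fixes d :: "'a \<Rightarrow> real"
  assumes "(\<Sum>l\<in>A. d l - c) = 0"
  shows "(\<Sum>l\<in>A. (d l - c)\<^sup>2) \<le> (\<Sum>l\<in>A. (d l)\<^sup>2)"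
proof -
  have "(\<Sum>l\<in>A. (d l)\<^sup>2) = (\<Sum>l\<in>A. (d l - c)\<^sup>2 + c\<^sup>2 + 2 * c * (d l - c))"
    by (intro sum.cong) (auto simp: power2_eq_square algebra_simps)
  also have "\<dots> = (\<Sum>l\<in>A. (d l - c)\<^sup>2) + (\<Sum>l\<in>A. c\<^sup>2) + 2 * c * (\<Sum>l\<in>A. d l - c)"
    by (simp only: sum.distrib sum_distrib_left)
  also have "\<dots> = (\<Sum>l\<in>A. (d l - c)\<^sup>2) + (\<Sum>l\<in>A. c\<^sup>2)"
    by (simp only: assms)
  finally show ?thesis by (simp add: sum_nonneg)
qed

subsection \<open>Mesh and nodal interpolation\<close>

lemma mesh_quasiperiodic:
  assumes "mesh N K K1 K2 nd"
  shows "nd (k + m * K) = nd k + m * (2 * int N)"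
proof -
  have shift: "nd (j + K) = nd j + 2 * int N" for j
    using assms by (simp add: mesh_def)
  show ?thesis
  proof (induction m rule: int_induct[where k = 0])
    case base
    then show ?case by simp
  next
    case (step1 i)
    then show ?case using shift[of "k + i * K"] by (simp add: algebra_simps)
  next
    case (step2 i)
    then show ?case using shift[of "k + (i - 1) * K"] by (simp add: algebra_simps)
  qed
qed

lemma mesh_0:
  assumes "mesh N K K1 K2 nd"
  shows "nd 0 = - int N"
proof -
  have "nd (0 + K) = nd 0 + 2 * int N" "nd K = int N"
    using assms unfolding mesh_def by blast+
  then show ?thesis by simp
qed

text \<open>Monotonicity is assumed only for the nodes 1 to \<open>K\<close>. The step from node 0
  to node 1 holds because node 1 lies in the cell while \<open>nd 0 = -N\<close>; all other steps
  are shifts of these by whole periods.\<close>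

lemma mesh_step:
  assumes "mesh N K K1 K2 nd"
  shows "nd (k - 1) < nd k"
proof -
  have K: "K \<ge> 1" and mono: "strict_mono_on {1..K} nd" and "nd ` {1..K} \<subseteq> lat_sites N"
    using assms by (auto simp: mesh_def)
  then have "nd 1 \<in> lat_sites N" by auto
  then have nd1: "nd 0 < nd 1" using mesh_0[OF assms] by (simp add: lat_sites_def)
  have cell: "nd (j - 1) < nd j" if "j \<in> {1..K}" for j
  proof (cases "j = 1")
    case True
    then show ?thesis using nd1 by simp
  next
    case False
    then show ?thesis using that by (intro strict_mono_onD[OF mono]) auto
  qed
  define j m where "j = (k - 1) mod K + 1" and "m = (k - 1) div K"
  have "(k - 1) mod K + (k - 1) div K * K = k - 1" by (rule mod_div_mult_eq)
  then have k: "k = j + m * K" by (simp add: j_def m_def)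
  have "j \<in> {1..K}" using K by (simp add: j_def add1_zle_eq)
  then show ?thesis
    using cell[of j] mesh_quasiperiodic[OF assms, of j m] mesh_quasiperiodic[OF assms, of "j - 1" m]
    by (simp add: k algebra_simps)
qed

lemma mesh_strict_mono:
  assumes "mesh N K K1 K2 nd" and "i < j"
  shows "nd i < nd j"
  using assms(2)
proof (induction j rule: int_gr_induct)
  case base
  then show ?case using mesh_step[OF assms(1), of "i + 1"] by simp
next
  case (step j)
  then show ?case using mesh_step[OF assms(1), of "j + 1"] by simp
qed

lemma mesh_mono:
  assumes "mesh N K K1 K2 nd" and "i \<le> j"
  shows "nd i \<le> nd j"
  using mesh_strict_mono[OF assms(1), of i j] assms(2) by (cases "i = j") auto

text \<open>Existence walks from \<open>nd 0\<close> one site at a time in both directions, changing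
  the element only when a node is crossed. For uniqueness, if \<open>i < j\<close> then every site
  of element \<open>i\<close> is at most \<open>nd (j - 1)\<close>, which element \<open>j\<close>
  excludes.\<close>

lemma elt_sites_ex1:
  assumes "mesh N K K1 K2 nd"
  shows "\<exists>!k. l \<in> elt_sites nd k"
proof (rule ex_ex1I)
  show "\<exists>k. l \<in> elt_sites nd k"
  proof (induction l rule: int_induct[where k = "nd 0"])
    case base
    then show ?case using mesh_step[OF assms, of 0] by (auto simp: elt_sites_def intro!: exI[of _ 0])
  next
    case (step1 l)
    then obtain k where k: "nd (k - 1) + 1 \<le> l" "l \<le> nd k" by (auto simp: elt_sites_def)
    show ?case
    proof (cases "l = nd k")
      case True
      then have "l + 1 \<in> elt_sites nd (k + 1)"
        using mesh_step[OF assms, of "k + 1"] by (simp add: elt_sites_def)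
      then show ?thesis ..
    next
      case False
      then have "l + 1 \<in> elt_sites nd k" using k by (simp add: elt_sites_def)
      then show ?thesis ..
    qed
  next
    case (step2 l)
    then obtain k where k: "nd (k - 1) + 1 \<le> l" "l \<le> nd k" by (auto simp: elt_sites_def)
    show ?case
    proof (cases "l - 1 = nd (k - 1)")
      case True
      then have "l - 1 \<in> elt_sites nd (k - 1)"
        using mesh_step[OF assms, of "k - 1"] by (simp add: elt_sites_def)
      then show ?thesis ..
    next
      case False
      then have "l - 1 \<in> elt_sites nd k" using k by (simp add: elt_sites_def)
      then show ?thesis ..
    qed
  qed
next
  fix i j
  assume ij: "l \<in> elt_sites nd i" "l \<in> elt_sites nd j"
  have "\<not> i < j" if "l \<in> elt_sites nd i" "l \<in> elt_sites nd j" for i j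
    using that mesh_mono[OF assms, of i "j - 1"] by (auto simp: elt_sites_def)
  then show "i = j" using ij by (meson linorder_neqE)
qed

lemma elt_sites_unique:
  assumes "mesh N K K1 K2 nd" and "l \<in> elt_sites nd i" and "l \<in> elt_sites nd j"
  shows "i = j"
  using elt_sites_ex1[OF assms(1), of l] assms(2,3) by auto

lemma sum_lat_sites_eq_sum_elt_sites:
  fixes g :: "int \<Rightarrow> 'a::comm_monoid_add"
  assumes "mesh N K K1 K2 nd"
  shows "(\<Sum>l\<in>lat_sites N. g l) = (\<Sum>k\<in>{1..K}. \<Sum>l\<in>elt_sites nd k. g l)"
proof -
  have *: "(\<Sum>l\<in>{nd 0 + 1..nd m}. g l) = (\<Sum>k\<in>{1..m}. \<Sum>l\<in>elt_sites nd k. g l)"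
    if "0 \<le> m" for m
    using that
  proof (induction m rule: int_ge_induct)
    case base
    then show ?case by simp
  next
    case (step m)
    have "(\<Sum>l\<in>{nd 0 + 1..nd (m + 1)}. g l)
        = (\<Sum>l\<in>{nd 0 + 1..nd m}. g l) + (\<Sum>l\<in>{nd m + 1..nd (m + 1)}. g l)"
      using step.hyps by (intro sum_int_concat mesh_mono[OF assms]) auto
    then show ?case
      using step sum_int_upper_Suc[of 0 m "\<lambda>k. \<Sum>l\<in>elt_sites nd k. g l"]
      by (simp add: elt_sites_def)
  qed
  have "0 \<le> K" "nd K = int N" using assms by (auto simp: mesh_def)
  then show ?thesis using *[of K] mesh_0[OF assms] by (simp add: lat_sites_def)
qed

lemma elt_of_eq:
  assumes "mesh N K K1 K2 nd" and "k \<in> {1..K}" and "l \<in> elt_sites nd k"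
  shows "elt_of N K nd l = k"
proof -
  have "nd 0 \<le> nd (k - 1)" "nd k \<le> nd K"
    using assms(2) by (auto intro!: mesh_mono[OF assms(1)])
  moreover have "nd K = int N" using assms(1) by (simp add: mesh_def)
  ultimately have "- int N + 1 \<le> l" "l \<le> int N"
    using mesh_0[OF assms(1)] assms(3) by (auto simp: elt_sites_def)
  \<comment> \<open>Inside the fundamental cell the reduction modulo \<open>2 * N\<close> in
    \<open>elt_of\<close> is the identity.\<close>
  then have "(l + int N - 1) mod (2 * int N) - int N + 1 = l" by simp
  then show ?thesis
    unfolding elt_of_def using assms elt_sites_unique[OF assms(1)] by (intro the_equality) auto
qed

text \<open>The slope is taken per lattice site; dividing it by \<open>lat_eps N\<close> gives the
  gradient on the element.\<close>

definition elt_slope :: "(int \<Rightarrow> int) \<Rightarrow> (int \<Rightarrow> real) \<Rightarrow> int \<Rightarrow> real" where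
  "elt_slope nd v k = (v (nd k) - v (nd (k - 1))) / of_int (nd k - nd (k - 1))"

text \<open>Summing the constant increment from the left node gives a linear formula, and its value
  at \<open>nd k\<close> identifies the increment. The left node is included although it is not a
  site of element \<open>k\<close>, since differences at the first site reach back to it.\<close>

lemma elt_affine_formula:
  assumes "N \<ge> 1" and "mesh N K K1 K2 nd" and "elt_affine N nd w"
    and "nd (k - 1) \<le> l" and "l \<le> nd k"
  shows "w l = w (nd (k - 1)) + of_int (l - nd (k - 1)) * elt_slope nd w k"
proof -
  obtain c where "\<forall>l\<in>elt_sites nd k. bdiff N w l = c"
    using assms(3) unfolding elt_affine_def by blast
  then have c: "w l - w (l - 1) = c / real N" if "l \<in> elt_sites nd k" for l
    using that assms(1) by (force simp: bdiff_def lat_eps_def field_simps)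
  have lin: "w l - w (nd (k - 1)) = of_int (l - nd (k - 1)) * (c / real N)"
    if "nd (k - 1) \<le> l" "l \<le> nd k" for l
  proof -
    have "w l - w (nd (k - 1)) = (\<Sum>j\<in>{nd (k - 1) + 1..l}. w j - w (j - 1))"
      using that by (simp add: sum_int_telescope)
    also have "\<dots> = (\<Sum>j\<in>{nd (k - 1) + 1..l}. c / real N)"
      using that by (intro sum.cong c) (auto simp: elt_sites_def)
    finally show ?thesis using that by simp
  qed
  have "nd (k - 1) < nd k" using mesh_step[OF assms(2)] .
  then have "elt_slope nd w k = c / real N"
    using lin[of "nd k"] by (simp add: elt_slope_def)
  then show ?thesis using lin[OF assms(4,5)] by simp
qed

text \<open>As \<open>nodal_interp\<close> is a definite description, existence and uniqueness must
  be shown first. The witness \<open>w\<close> is the explicit linear formula on each element; a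
  competitor equals it because end values determine an affine function on an element.\<close>

lemma nodal_interp_props:
  assumes "N \<ge> 1" and m: "mesh N K K1 K2 nd" and per: "lat_periodic N v"
  defines "vh \<equiv> nodal_interp N nd v"
  shows "elt_affine N nd vh" and "vh (nd k) = v (nd k)"
proof -
  let ?P = "\<lambda>w. lat_periodic N w \<and> elt_affine N nd w \<and> (\<forall>k. w (nd k) = v (nd k))"
  define idx where "idx l = (THE k. l \<in> elt_sites nd k)" for l
  have idx: "idx l = k" if "l \<in> elt_sites nd k" for l k
    unfolding idx_def using that elt_sites_unique[OF m] by blast
  define w where "w l = v (nd (idx l - 1)) + of_int (l - nd (idx l - 1)) * elt_slope nd v (idx l)" for l
  have node: "nd k \<in> elt_sites nd k" for k
    using mesh_step[OF m, of k] by (simp add: elt_sites_def)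
  have wnode: "w (nd k) = v (nd k)" for k
    using mesh_step[OF m, of k] by (simp add: w_def idx[OF node] elt_slope_def)
  \<comment> \<open>At \<open>l = nd (k - 1)\<close> the definition of \<open>w\<close> uses element
    \<open>k - 1\<close>, but the formula of element \<open>k\<close> gives the same nodal value.
    This makes the difference quotient at the first site of element \<open>k\<close> agree with the
    others.\<close>
  have wform: "w l = v (nd (k - 1)) + of_int (l - nd (k - 1)) * elt_slope nd v k"
    if "nd (k - 1) \<le> l" "l \<le> nd k" for l k
  proof (cases "l = nd (k - 1)")
    case True
    then show ?thesis by (simp add: wnode)
  next
    case False
    then show ?thesis using that by (simp add: w_def idx[of l k] elt_sites_def)
  qed
  have "bdiff N w l = elt_slope nd v k / lat_eps N" if "l \<in> elt_sites nd k" for l k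
    using that wform[of k l] wform[of k "l - 1"] by (simp add: bdiff_def elt_sites_def algebra_simps)
  then have aff: "elt_affine N nd w" unfolding elt_affine_def by blast
  have shift: "nd (k + K) = nd k + 2 * int N" for k using m by (simp add: mesh_def)
  have "w (l + 2 * int N) = w l" for l
  proof -
    obtain k where k: "l \<in> elt_sites nd k" using elt_sites_ex1[OF m, of l] by blast
    have s: "nd (k + K - 1) = nd (k - 1) + 2 * int N" using shift[of "k - 1"] by (simp add: algebra_simps)
    have v: "v (j + 2 * int N) = v j" for j using per by (simp add: lat_periodic_def)
    show ?thesis
      using k wform[of k l] wform[of "k + K" "l + 2 * int N"]
      by (simp add: elt_sites_def shift s v elt_slope_def)
  qed
  then have Pw: "?P w" using aff wnode by (simp add: lat_periodic_def)
  have "u = w" if "?P u" for u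
  proof
    fix l
    obtain k where k: "l \<in> elt_sites nd k" using elt_sites_ex1[OF m, of l] by blast
    then show "u l = w l"
      using elt_affine_formula[OF assms(1) m, of u k l] elt_affine_formula[OF assms(1) m, of w k l]
        that Pw by (simp add: elt_sites_def elt_slope_def)
  qed
  then have "?P (nodal_interp N nd v)"
    unfolding nodal_interp_def using Pw by (intro theI[of ?P w])
  then show "elt_affine N nd vh" and "vh (nd k) = v (nd k)" by (auto simp: vh_def)
qed

subsection \<open>The coarse-graining residual\<close>

lemma R_cg_eq:
  assumes "N \<ge> 1" and m: "mesh N K K1 K2 nd" and per: "lat_periodic N v"
  shows "R_cg N K K1 K2 nd V y f v
    = - lat_eps N * (\<Sum>l\<in>lat_sites N. f l * (v l - nodal_interp N nd v l))"
proof -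
  define vh where "vh = nodal_interp N nd v"
  define s where "s = sigma_ac N K K1 K2 nd V y"
  note vh = nodal_interp_props[OF assms, folded vh_def]
  have elt: "(\<Sum>l\<in>elt_sites nd k. s l * bdiff N v l) = (\<Sum>l\<in>elt_sites nd k. s l * bdiff N vh l)"
    if k: "k \<in> {1..K}" for k
  proof -
    have le: "nd (k - 1) \<le> nd k" using mesh_step[OF m, of k] by simp
    \<comment> \<open>The constant stress factors out and the rest telescopes to the end values of
      \<open>u\<close>, which coincide for \<open>v\<close> and \<open>vh\<close>.\<close>
    have "(\<Sum>l\<in>elt_sites nd k. s l * bdiff N u l)
        = sigma_ac_elt N K K1 K2 nd V y k / lat_eps N * (u (nd k) - u (nd (k - 1)))" for u
    proof -
      have "(\<Sum>l\<in>elt_sites nd k. s l * bdiff N u l)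
        = (\<Sum>l\<in>elt_sites nd k. sigma_ac_elt N K K1 K2 nd V y k / lat_eps N * (u l - u (l - 1)))"
        by (intro sum.cong) (auto simp: s_def sigma_ac_def elt_of_eq[OF m k] bdiff_def)
      also have "\<dots> = sigma_ac_elt N K K1 K2 nd V y k / lat_eps N
          * (\<Sum>l\<in>{nd (k - 1) + 1..nd k}. u l - u (l - 1))"
        by (simp only: sum_distrib_left elt_sites_def)
      finally show ?thesis using le by (simp only: sum_int_telescope)
    qed
    then show ?thesis by (simp add: vh)
  qed
  have "(\<Sum>l\<in>lat_sites N. s l * bdiff N v l) = (\<Sum>l\<in>lat_sites N. s l * bdiff N vh l)"
    unfolding sum_lat_sites_eq_sum_elt_sites[OF m] by (intro sum.cong refl elt)
  then have "R_cg N K K1 K2 nd V y f v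
    = - lat_eps N * (\<Sum>l\<in>lat_sites N. f l * v l) + lat_eps N * (\<Sum>l\<in>lat_sites N. f l * vh l)"
    unfolding R_cg_def Let_def vh_def[symmetric] s_def[symmetric] by simp
  then show ?thesis
    by (simp add: vh_def[symmetric] algebra_simps sum_subtractf)
qed

text \<open>The error vanishes at both end nodes, so \<open>discrete_poincare\<close> applies. Its
  increments are those of \<open>v\<close> minus their mean, and centering does not increase the sum
  of squares. Passing to \<open>bdiff\<close> gives the \<open>lat_eps\<close> that turns the site
  count into \<open>elt_h\<close>.\<close>

lemma interp_error_elt_le:
  assumes "N \<ge> 1" and m: "mesh N K K1 K2 nd" and per: "lat_periodic N v"
  shows "(\<Sum>l\<in>elt_sites nd k. (v l - nodal_interp N nd v l)\<^sup>2)
    \<le> (elt_h N nd k)\<^sup>2 / 4 * (\<Sum>l\<in>elt_sites nd k. (bdiff N v l)\<^sup>2)"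
proof -
  define vh where "vh = nodal_interp N nd v"
  note vh = nodal_interp_props[OF assms, folded vh_def]
  define a b where "a = nd (k - 1)" and "b = nd k"
  have ab: "a < b" using mesh_step[OF m, of k] by (simp add: a_def b_def)
  have sites: "elt_sites nd k = {a+1..b}" by (simp add: elt_sites_def a_def b_def)
  define e where "e l = v l - vh l" for l
  have e0: "e a = 0" "e b = 0" by (simp_all add: e_def a_def b_def vh)
  define c where "c = elt_slope nd vh k"
  have diff: "e l - e (l - 1) = (v l - v (l - 1)) - c" if "l \<in> {a+1..b}" for l
    using that elt_affine_formula[OF assms(1) m vh(1), of k l]
      elt_affine_formula[OF assms(1) m vh(1), of k "l - 1"]
    by (simp add: e_def a_def b_def c_def algebra_simps)
  have "(\<Sum>l\<in>{a+1..b}. (v l - v (l - 1)) - c) = (\<Sum>l\<in>{a+1..b}. e l - e (l - 1))"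
    using diff by (intro sum.cong) auto
  also have "\<dots> = 0" using ab by (simp add: sum_int_telescope e0)
  finally have "(\<Sum>l\<in>{a+1..b}. ((v l - v (l - 1)) - c)\<^sup>2) \<le> (\<Sum>l\<in>{a+1..b}. (v l - v (l - 1))\<^sup>2)"
    by (rule sum_square_centered_le)
  moreover have "(\<Sum>l\<in>{a+1..b}. (e l - e (l - 1))\<^sup>2) = (\<Sum>l\<in>{a+1..b}. ((v l - v (l - 1)) - c)\<^sup>2)"
    by (intro sum.cong refl) (simp only: diff)
  ultimately have "(\<Sum>l\<in>{a+1..b}. (e l - e (l - 1))\<^sup>2) \<le> (\<Sum>l\<in>{a+1..b}. (v l - v (l - 1))\<^sup>2)"
    by simp
  also have "\<dots> = (lat_eps N)\<^sup>2 * (\<Sum>l\<in>{a+1..b}. (bdiff N v l)\<^sup>2)"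
    using assms(1) by (simp add: sum_distrib_left bdiff_def lat_eps_def power_divide power_mult_distrib)
  finally have D: "(\<Sum>l\<in>{a+1..b}. (e l - e (l - 1))\<^sup>2)
    \<le> (lat_eps N)\<^sup>2 * (\<Sum>l\<in>{a+1..b}. (bdiff N v l)\<^sup>2)" .
  have "(\<Sum>l\<in>{a+1..b}. (e l)\<^sup>2)
    \<le> (of_int (b - a))\<^sup>2 / 4 * (\<Sum>l\<in>{a+1..b}. (e l - e (l - 1))\<^sup>2)"
    using discrete_poincare[OF ab, of e] e0 by simp
  also have "\<dots> \<le> (of_int (b - a))\<^sup>2 / 4 * ((lat_eps N)\<^sup>2 * (\<Sum>l\<in>{a+1..b}. (bdiff N v l)\<^sup>2))"
    by (intro mult_left_mono D) auto
  finally show ?thesis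
    by (simp add: sites e_def vh_def elt_h_def a_def b_def power_mult_distrib mult_ac)
qed

text \<open>The share of element \<open>k\<close> in the square of the claimed bound: indicator plus
  data oscillation.\<close>

definition elt_bound :: "nat \<Rightarrow> (int \<Rightarrow> int) \<Rightarrow> (int \<Rightarrow> real) \<Rightarrow> (int \<Rightarrow> real) \<Rightarrow> int \<Rightarrow> real" where
  "elt_bound N nd f fbar k = (eta_elt N nd fbar k)\<^sup>2
    + (elt_h N nd k)\<^sup>2 * (l2norm N (elt_sites nd k) (\<lambda>l. f l - fbar k))\<^sup>2 / 2"

lemma elt_bound_eq:
  "elt_bound N nd f fbar k = (elt_h N nd k)\<^sup>2 / 2 *
    (lat_eps N * (\<Sum>l\<in>elt_sites nd k. (fbar k)\<^sup>2 + (f l - fbar k)\<^sup>2))"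
proof -
  have "lat_eps N \<ge> 0" by (simp add: lat_eps_def)
  then show ?thesis
    by (simp add: elt_bound_def eta_elt_def l2norm_def sum_nonneg sum.distrib algebra_simps add_divide_distrib)
qed

text \<open>Cauchy-Schwarz on the element. The constant arises as 2, from splitting
  \<open>f\<close>, times \<open>h^2 / 4\<close>, from the interpolation error, which is the
  \<open>h^2 / 2\<close> of \<open>elt_bound_eq\<close>.\<close>

lemma residual_elt_le:
  assumes "N \<ge> 1" and m: "mesh N K K1 K2 nd" and per: "lat_periodic N v"
  shows "\<bar>lat_eps N * (\<Sum>l\<in>elt_sites nd k. f l * (v l - nodal_interp N nd v l))\<bar>
    \<le> sqrt (elt_bound N nd f fbar k) * l2norm N (elt_sites nd k) (bdiff N v)"
proof -
  define T where "T = elt_sites nd k"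
  define e where "e l = v l - nodal_interp N nd v l" for l
  define eps where "eps = lat_eps N"
  define h where "h = elt_h N nd k"
  define A where "A = (\<Sum>l\<in>T. (fbar k)\<^sup>2 + (f l - fbar k)\<^sup>2)"
  define B where "B = (\<Sum>l\<in>T. (bdiff N v l)\<^sup>2)"
  have AB: "A \<ge> 0" "B \<ge> 0" by (auto simp: A_def B_def intro!: sum_nonneg)
  \<comment> \<open>The two sides differ by \<open>(f l - 2 * fbar k)^2\<close>. As
    \<open>fbar k\<close> may be any number, the cross term need not cancel in the sum, and the
    splitting costs a factor 2.\<close>
  have sq: "(f l)\<^sup>2 \<le> 2 * ((fbar k)\<^sup>2 + (f l - fbar k)\<^sup>2)" for l
    using zero_le_power2[of "f l - 2 * fbar k"] by (simp add: power2_eq_square algebra_simps)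
  have f: "(\<Sum>l\<in>T. (f l)\<^sup>2) \<le> 2 * A"
    unfolding A_def sum_distrib_left by (intro sum_mono sq)
  have "(\<Sum>l\<in>T. f l * e l)\<^sup>2 \<le> (\<Sum>l\<in>T. (f l)\<^sup>2) * (\<Sum>l\<in>T. (e l)\<^sup>2)"
    by (rule Cauchy_Schwarz_ineq_sum)
  also have "\<dots> \<le> (2 * A) * (h\<^sup>2 / 4 * B)"
    using f interp_error_elt_le[OF assms, of k] AB
    by (intro mult_mono) (auto simp: T_def e_def h_def B_def sum_nonneg)
  finally have "eps\<^sup>2 * (\<Sum>l\<in>T. f l * e l)\<^sup>2 \<le> eps\<^sup>2 * ((2 * A) * (h\<^sup>2 / 4 * B))"
    by (intro mult_left_mono) auto
  also have "\<dots> = elt_bound N nd f fbar k * (eps * B)"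
    by (simp add: elt_bound_eq A_def eps_def h_def T_def power2_eq_square)
  finally have "(eps * (\<Sum>l\<in>T. f l * e l))\<^sup>2 \<le> elt_bound N nd f fbar k * (eps * B)"
    by (simp add: power_mult_distrib)
  then have "\<bar>eps * (\<Sum>l\<in>T. f l * e l)\<bar> \<le> sqrt (elt_bound N nd f fbar k * (eps * B))"
    by (metis real_sqrt_abs real_sqrt_le_mono)
  then show ?thesis
    by (simp add: real_sqrt_mult l2norm_def T_def e_def eps_def B_def)
qed

lemma R_cg_le:
  assumes "N \<ge> 1" and m: "mesh N K K1 K2 nd" and per: "lat_periodic N v"
    and v1: "l2norm N (lat_sites N) (bdiff N v) = 1"
  shows "R_cg N K K1 K2 nd V y f v \<le> sqrt (\<Sum>k\<in>Kc_elts K K1 K2. elt_bound N nd f fbar k)"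
proof -
  define r where "r k = lat_eps N * (\<Sum>l\<in>elt_sites nd k. f l * (v l - nodal_interp N nd v l))" for k
  define b where "b k = l2norm N (elt_sites nd k) (bdiff N v)" for k
  have eps: "lat_eps N \<ge> 0" by (simp add: lat_eps_def)
  have bnn: "elt_bound N nd f fbar k \<ge> 0" for k
    by (simp add: elt_bound_def)
  have sub: "Kc_elts K K1 K2 \<subseteq> {1..K}"
    using m by (auto simp: Kc_elts_def Kc_def mesh_def)
  \<comment> \<open>The remaining elements, \<open>K1 - 1\<close> to \<open>K2 + 2\<close>, consist
    of the single site \<open>nd k\<close>, where the interpolation error is zero.\<close>
  have r0: "r k = 0" if "k \<in> {1..K} - Kc_elts K K1 K2" for k
  proof -
    have "k \<in> {K1 - 1..K2 + 2}" using that m by (auto simp: Kc_elts_def Kc_def mesh_def)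
    then have "nd k - nd (k - 1) = 1" using m by (simp add: mesh_def)
    then have "elt_sites nd k = {nd k}" by (auto simp: elt_sites_def)
    then show ?thesis by (simp add: r_def nodal_interp_props[OF assms(1-3)])
  qed
  have "R_cg N K K1 K2 nd V y f v = - (\<Sum>k\<in>{1..K}. r k)"
    by (simp add: R_cg_eq[OF assms(1-3)] sum_lat_sites_eq_sum_elt_sites[OF m] r_def
        flip: sum_distrib_left)
  also have "(\<Sum>k\<in>{1..K}. r k) = (\<Sum>k\<in>Kc_elts K K1 K2. r k)"
    using sub r0 by (intro sum.mono_neutral_right) auto
  also have "- \<dots> \<le> (\<Sum>k\<in>Kc_elts K K1 K2. \<bar>r k\<bar>)"
    using sum_abs[of r "Kc_elts K K1 K2"] by linarith
  also have "\<dots> \<le> (\<Sum>k\<in>Kc_elts K K1 K2. \<bar>sqrt (elt_bound N nd f fbar k)\<bar> * \<bar>b k\<bar>)"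
    using residual_elt_le[OF assms(1-3)] bnn eps
    by (intro sum_mono) (auto simp: r_def b_def l2norm_def sum_nonneg)
  also have "\<dots> \<le> sqrt (\<Sum>k\<in>Kc_elts K K1 K2. elt_bound N nd f fbar k)
      * sqrt (\<Sum>k\<in>Kc_elts K K1 K2. (b k)\<^sup>2)"
    using L2_set_mult_ineq[of "\<lambda>k. sqrt (elt_bound N nd f fbar k)" b "Kc_elts K K1 K2"] bnn
    by (simp add: L2_set_def)
  also have "\<dots> \<le> sqrt (\<Sum>k\<in>Kc_elts K K1 K2. elt_bound N nd f fbar k) * 1"
  proof (intro mult_left_mono)
    \<comment> \<open>The elements 1 to \<open>K\<close> partition the cell, so the squared local
      norms add up to the squared global norm, which is 1.\<close>
    have "(\<Sum>k\<in>Kc_elts K K1 K2. (b k)\<^sup>2) \<le> (\<Sum>k\<in>{1..K}. (b k)\<^sup>2)"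
      using sub by (intro sum_mono2) auto
    also have "\<dots> = (l2norm N (lat_sites N) (bdiff N v))\<^sup>2"
      using eps by (simp add: b_def l2norm_def sum_nonneg sum_lat_sites_eq_sum_elt_sites[OF m] sum_distrib_left)
    finally show "sqrt (\<Sum>k\<in>Kc_elts K K1 K2. (b k)\<^sup>2) \<le> 1" by (simp add: v1)
  qed (simp add: bnn sum_nonneg)
  finally show ?thesis by simp
qed

text \<open>Each element in \<open>Kc_elts\<close> passes half of its squared indicator to each end
  node. The nodes \<open>K1 - 2\<close> and \<open>K2 + 2\<close> border only one such element,
  hence their one-term formulas, while node \<open>K\<close> collects from element \<open>K\<close>
  and, across the period, from element 1.\<close>

lemma sum_eta_node_eq:
  assumes m: "mesh N K K1 K2 nd"
  shows "(\<Sum>k\<in>Kc K K1 K2. (eta_node N K K1 K2 nd fbar k)\<^sup>2)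
    = (\<Sum>k\<in>Kc_elts K K1 K2. (eta_elt N nd fbar k)\<^sup>2)"
proof -
  have K: "3 \<le> K1" "K1 + 2 < K2 - 1" "K2 + 3 \<le> K" using m by (auto simp: mesh_def)
  define q where "q k = (eta_elt N nd fbar k)\<^sup>2 / 2" for k
  define p where "p k = (eta_node N K K1 K2 nd fbar k)\<^sup>2" for k
  have half: "(sqrt 2 / 2 * x)\<^sup>2 = x\<^sup>2 / 2" for x :: real
    by (simp add: power_mult_distrib power_divide)
  have int: "p k = q k + q (per_index K (k + 1))" if "k \<in> {1..K1 - 3} \<union> {K2 + 3..K}" for k
  proof -
    have "k \<in> Kc_interior K K1 K2" using that K by (auto simp: Kc_interior_def Kc_def)
    then show ?thesis
      by (simp only: p_def q_def eta_node_def half if_True) (simp add: add_divide_distrib)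
  qed
  have ends: "p (K1 - 2) = q (K1 - 2)" "p (K2 + 2) = q (K2 + 3)"
    using K by (simp_all add: p_def q_def eta_node_def half Kc_interior_def del: times_divide_eq_left)
  have idx: "per_index K (k + 1) = k + 1" if "k \<in> {1..K - 1}" for k
    using that by (simp add: per_index_def)
  have idxK: "per_index K (K + 1) = 1" by (simp add: per_index_def)
  have shift: "(\<Sum>k\<in>{a..b}. q (k + 1)) = (\<Sum>k\<in>{a+1..b+1}. q k)" for a b
    by (rule sum.reindex_bij_witness[of _ "\<lambda>k. k - 1" "\<lambda>k. k + 1"]) auto
  \<comment> \<open>Element 1 is counted once only: its left end node is node 0, represented by node
    \<open>K\<close> in the other block.\<close>
  have left: "(\<Sum>k\<in>{1..K1 - 2}. p k) = 2 * (\<Sum>k\<in>{1..K1 - 2}. q k) - q 1"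
  proof -
    have "{1..K1 - 2} = insert (K1 - 2) {1..K1 - 3}" using K by auto
    then have "(\<Sum>k\<in>{1..K1 - 2}. p k) = p (K1 - 2) + (\<Sum>k\<in>{1..K1 - 3}. p k)" by simp
    also have "(\<Sum>k\<in>{1..K1 - 3}. p k) = (\<Sum>k\<in>{1..K1 - 3}. q k + q (k + 1))"
      using K by (intro sum.cong) (auto simp: int idx)
    also have "\<dots> = (\<Sum>k\<in>{1..K1 - 3}. q k) + (\<Sum>k\<in>{2..K1 - 2}. q k)"
      using shift[of 1 "K1 - 3"] by (simp add: sum.distrib)
    finally have 1: "(\<Sum>k\<in>{1..K1 - 2}. p k)
      = q (K1 - 2) + ((\<Sum>k\<in>{1..K1 - 3}. q k) + (\<Sum>k\<in>{2..K1 - 2}. q k))" by (simp add: ends)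
    have "{1..K1 - 2} = insert (K1 - 2) {1..K1 - 3}" using K by auto
    then have 2: "(\<Sum>k\<in>{1..K1 - 2}. q k) = q (K1 - 2) + (\<Sum>k\<in>{1..K1 - 3}. q k)" by simp
    have "{1..K1 - 2} = insert 1 {2..K1 - 2}" using K by auto
    then have 3: "(\<Sum>k\<in>{1..K1 - 2}. q k) = q 1 + (\<Sum>k\<in>{2..K1 - 2}. q k)" by simp
    show ?thesis using 1 2 3 by simp
  qed
  \<comment> \<open>The extra \<open>q 1\<close> comes from node \<open>K\<close> and makes up for
    the half missing in \<open>left\<close>.\<close>
  have right: "(\<Sum>k\<in>{K2 + 2..K}. p k) = 2 * (\<Sum>k\<in>{K2 + 3..K}. q k) + q 1"
  proof -
    have "{K2 + 2..K} = insert (K2 + 2) (insert K {K2 + 3..K - 1})" using K by auto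
    then have "(\<Sum>k\<in>{K2 + 2..K}. p k) = q (K2 + 3) + (p K + (\<Sum>k\<in>{K2 + 3..K - 1}. p k))"
      using K by (simp add: ends)
    also have "p K = q K + q 1" using K by (simp add: int idxK)
    also have "(\<Sum>k\<in>{K2 + 3..K - 1}. p k) = (\<Sum>k\<in>{K2 + 3..K - 1}. q k + q (k + 1))"
      using K by (intro sum.cong) (auto simp: int idx)
    also have "\<dots> = (\<Sum>k\<in>{K2 + 3..K - 1}. q k) + (\<Sum>k\<in>{K2 + 4..K}. q k)"
      using shift[of "K2 + 3" "K - 1"] by (simp add: sum.distrib add.assoc)
    finally have 1: "(\<Sum>k\<in>{K2 + 2..K}. p k) = q (K2 + 3)
      + (q K + q 1 + ((\<Sum>k\<in>{K2 + 3..K - 1}. q k) + (\<Sum>k\<in>{K2 + 4..K}. q k)))" .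
    have "{K2 + 3..K} = insert K {K2 + 3..K - 1}" using K by auto
    then have 2: "(\<Sum>k\<in>{K2 + 3..K}. q k) = q K + (\<Sum>k\<in>{K2 + 3..K - 1}. q k)" by simp
    have "{K2 + 3..K} = insert (K2 + 3) {K2 + 4..K}" using K by auto
    then have 3: "(\<Sum>k\<in>{K2 + 3..K}. q k) = q (K2 + 3) + (\<Sum>k\<in>{K2 + 4..K}. q k)" by simp
    show ?thesis using 1 2 3 by simp
  qed
  have "(\<Sum>k\<in>Kc K K1 K2. p k) = (\<Sum>k\<in>{1..K1 - 2}. p k) + (\<Sum>k\<in>{K2 + 2..K}. p k)"
    unfolding Kc_def using K by (intro sum.union_disjoint) auto
  also have "\<dots> = 2 * ((\<Sum>k\<in>{1..K1 - 2}. q k) + (\<Sum>k\<in>{K2 + 3..K}. q k))"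
    by (simp add: left right)
  also have "(\<Sum>k\<in>{1..K1 - 2}. q k) + (\<Sum>k\<in>{K2 + 3..K}. q k) = (\<Sum>k\<in>Kc_elts K K1 K2. q k)"
  proof -
    have "Kc_elts K K1 K2 = {1..K1 - 2} \<union> {K2 + 3..K}" using K by (auto simp: Kc_elts_def Kc_def)
    moreover have "{1..K1 - 2} \<inter> {K2 + 3..K} = {}" using K by auto
    ultimately show ?thesis by (simp add: sum.union_disjoint)
  qed
  finally show ?thesis by (simp add: p_def q_def flip: sum_divide_distrib)
qed

theorem theorem4:
  fixes N :: nat and F :: real and K K1 K2 :: int and nd :: "int \<Rightarrow> int"
    and V :: "strain \<Rightarrow> real" and yh f fbar :: "int \<Rightarrow> real"
  assumes "N \<ge> 1" and "F > 0"
    and "Ck_on 3 V pot_domain"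
    and "mesh N K K1 K2 nd"
    and "yh \<in> Yh_space N F nd"
    and "Min ((\<lambda>k. elt_grad N nd yh k) ` {1..K}) > 0"
    and "f \<in> U_space N"
  shows "dual_norm N (R_cg N K K1 K2 nd V yh f)
      \<le> ereal (sqrt ((\<Sum>k\<in>Kc_elts K K1 K2. (eta_elt N nd fbar k)\<^sup>2)
                   + 1 / 2 * data_osc N K K1 K2 nd f fbar))
    \<and> sqrt ((\<Sum>k\<in>Kc_elts K K1 K2. (eta_elt N nd fbar k)\<^sup>2)
          + 1 / 2 * data_osc N K K1 K2 nd f fbar)
      = sqrt ((\<Sum>k\<in>Kc K K1 K2. (eta_node N K K1 K2 nd fbar k)\<^sup>2)
          + 1 / 2 * data_osc N K K1 K2 nd f fbar)"
proof (rule conjI)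
  have "ereal (R_cg N K K1 K2 nd V yh f v)
      \<le> ereal (sqrt (\<Sum>k\<in>Kc_elts K K1 K2. elt_bound N nd f fbar k))"
    if "v \<in> U_space N" "l2norm N (lat_sites N) (bdiff N v) = 1" for v
    using that R_cg_le[OF assms(1,4)] by (simp add: U_space_def)
  then have "dual_norm N (R_cg N K K1 K2 nd V yh f)
      \<le> ereal (sqrt (\<Sum>k\<in>Kc_elts K K1 K2. elt_bound N nd f fbar k))"
    unfolding dual_norm_def by (intro SUP_least) auto
  \<comment> \<open>Summing \<open>elt_bound\<close> separates the indicators from half of
    \<open>data_osc\<close>.\<close>
  then show "dual_norm N (R_cg N K K1 K2 nd V yh f)
      \<le> ereal (sqrt ((\<Sum>k\<in>Kc_elts K K1 K2. (eta_elt N nd fbar k)\<^sup>2)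
                   + 1 / 2 * data_osc N K K1 K2 nd f fbar))"
    by (simp add: elt_bound_def data_osc_def sum.distrib sum_divide_distrib)
qed (simp only: sum_eta_node_eq[OF assms(4)])

end
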